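(* Let $X_1,\dots,X_n$ be i.i.d. $\sigma$-subGaussian random variables, and let $U\sim\mathrm{Unif}(0,1)$ be an independent random variable. Then, for all $\alpha\in(0,1)$, $$P\left(\bar X_n-\mathbb E[X]\ge \sigma\sqrt{\frac{2\log(1/\alpha)}{n}}+\sigma\,\frac{\log(U)}{\sqrt{2n\log(1/\alpha)}}\right)\le\alpha.$$
   Context: A random variable $X$ is called $\sigma$-subGaussian if $\mathbb E[\exp(\lambda(X-\mathbb E[X]))]\le\exp(\lambda^2\sigma^2/2)$ for any constant $\lambda$. Here $\bar X_n=(X_1+\dots+X_n)/n$, $\mathbb E[X]$ denotes the common mean of the $X_i$, and $U$ is independent of $(X_1,\dots,X_n)$. *)

theory Defs
  imports "HOL-Probability.Probability"
begin

(* The integrability conditions make the expectations meaningful: the Bochner integral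
   of a non-integrable function is 0, which would satisfy the bound vacuously. *)
definition subgaussian :: "'a measure \<Rightarrow> real \<Rightarrow> ('a \<Rightarrow> real) \<Rightarrow> bool" where
  "subgaussian M \<sigma> X \<longleftrightarrow>
     integrable M X \<and>
     (\<forall>l::real.
        integrable M (\<lambda>\<omega>. exp (l * (X \<omega> - (\<integral>\<omega>'. X \<omega>' \<partial>M)))) \<and>
        (\<integral>\<omega>. exp (l * (X \<omega> - (\<integral>\<omega>'. X \<omega>' \<partial>M))) \<partial>M) \<le> exp (l\<^sup>2 * \<sigma>\<^sup>2 / 2))"

definition iid :: "'a measure \<Rightarrow> 'i set \<Rightarrow> ('i \<Rightarrow> 'a \<Rightarrow> real) \<Rightarrow> bool" where
  "iid M I X \<longleftrightarrow>
     prob_space.indep_vars M (\<lambda>_. borel) X I \<and>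
     (\<forall>i\<in>I. \<forall>j\<in>I. distr M borel (X i) = distr M borel (X j))"

(* The constant indep_var forces both variables to have the same value type;
   here they may differ (a real variable against a random vector). *)
definition indep_rv ::
  "'a measure \<Rightarrow> 'b measure \<Rightarrow> ('a \<Rightarrow> 'b) \<Rightarrow> 'c measure \<Rightarrow> ('a \<Rightarrow> 'c) \<Rightarrow> bool" where
  "indep_rv M S X T Y \<longleftrightarrow>
     X \<in> measurable M S \<and> Y \<in> measurable M T \<and>
     prob_space.indep_set M
       (sets (vimage_algebra (space M) X S)) (sets (vimage_algebra (space M) Y T))"

definition sample_mean :: "nat \<Rightarrow> (nat \<Rightarrow> 'a \<Rightarrow> real) \<Rightarrow> 'a \<Rightarrow> real" where
  "sample_mean n X \<omega> = (\<Sum>i=1..n. X i \<omega>) / real n"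

end

theory Submission
  imports Defs
begin

text \<open>
  The bound is Markov's inequality applied to the Chernoff variable
  \<open>W = exp (l * (\<Sum>i. X i - \<mu>) - n * l\<^sup>2 * \<sigma>\<^sup>2 / 2)\<close>, whose mean is at most 1, in its
  randomized form: for a nonnegative \<open>Z\<close> and an independent uniform \<open>U\<close> one has
  \<open>P (U \<le> Z) = E (min 1 Z) \<le> E Z\<close>.  With \<open>l = sqrt (2 * ln (1 / \<alpha>) / n) / \<sigma>\<close> the event in
  question is \<open>U \<le> \<alpha> * W\<close>, up to the null event \<open>U \<le> 0\<close>; for this \<open>l\<close> the normalizing
  factor of \<open>W\<close> is \<open>\<alpha>\<close>, so that \<open>\<alpha> * W = \<alpha>\<^sup>2 * exp (l * (\<Sum>i. X i - \<mu>))\<close>.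
\<close>

text \<open>The \<open>\<sigma>\<close>-algebra generated by \<open>f \<circ> Y\<close> lies inside
  the one generated by \<open>Y\<close>, and independence passes to smaller families. This turns
  \<open>indep_rv\<close>, stated for a random vector \<open>Y\<close>, into the library's
  \<open>indep_var\<close> between two real variables.\<close>

lemma (in prob_space) indep_rv_compose:
  fixes U :: "'a \<Rightarrow> real" and f :: "'c \<Rightarrow> real"
  assumes ind: "indep_rv M borel U T Y" and f: "f \<in> borel_measurable T"
  shows "indep_var borel U borel (\<lambda>\<omega>. f (Y \<omega>))"
proof -
  have U [measurable]: "U \<in> borel_measurable M" and Y [measurable]: "Y \<in> measurable M T"
    and S: "indep_set (sets (vimage_algebra (space M) U borel)) (sets (vimage_algebra (space M) Y T))"
    using ind by (auto simp: indep_rv_def)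
  note f [measurable]
  \<comment> \<open>Measurability is taken with respect to the pullback of \<open>T\<close> along
    \<open>Y\<close>, not just \<open>M\<close>; this is what gives the second inclusion
    below.\<close>
  have fY: "(\<lambda>\<omega>. f (Y \<omega>)) \<in> borel_measurable (vimage_algebra (space M) Y T)"
    using measurable_space[OF Y]
    by (intro measurable_compose[OF _ f] measurable_vimage_algebra1) auto
  have 1: "sigma_sets (space M) {U -` A \<inter> space M |A. A \<in> sets borel}
      \<subseteq> sets (vimage_algebra (space M) U borel)"
    by (simp add: sets_vimage_algebra)
  have 2: "sigma_sets (space M) {(\<lambda>\<omega>. f (Y \<omega>)) -` A \<inter> space M |A. A \<in> sets borel}
      \<subseteq> sets (vimage_algebra (space M) Y T)"
    using measurable_sets[OF fY]
    by (intro sets.sigma_sets_subset[where M = "vimage_algebra (space M) Y T", simplified]) auto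
  have "indep_set (sigma_sets (space M) {U -` A \<inter> space M |A. A \<in> sets borel})
      (sigma_sets (space M) {(\<lambda>\<omega>. f (Y \<omega>)) -` A \<inter> space M |A. A \<in> sets borel})"
    using S unfolding indep_set_def
    by (rule indep_sets_mono_sets) (use 1 2 in \<open>auto split: bool.split\<close>)
  moreover have "(\<lambda>\<omega>. f (Y \<omega>)) \<in> borel_measurable M"
    by measurable
  ultimately show ?thesis
    unfolding indep_var_eq using U by blast
qed

text \<open>By independence the joint law is a product, so Fubini reduces the claim to fixed
  \<open>z\<close>, where the uniform law gives \<open>{..z}\<close> mass at most
  \<open>ennreal z\<close>.\<close>

lemma (in prob_space) randomized_Markov:
  fixes U Z :: "'a \<Rightarrow> real"
  assumes ind: "indep_var borel U borel Z"
    and unif: "distr M borel U = uniform_measure lborel {0<..<1}"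
  shows "emeasure M {\<omega> \<in> space M. U \<omega> \<le> Z \<omega>} \<le> (\<integral>\<^sup>+\<omega>. ennreal (Z \<omega>) \<partial>M)"
proof -
  have [measurable]: "U \<in> borel_measurable M" "Z \<in> borel_measurable M"
    using indep_var_rv1[OF ind] indep_var_rv2[OF ind] by auto
  interpret DU: prob_space "distr M borel U" by (rule prob_space_distr) simp
  interpret DZ: prob_space "distr M borel Z" by (rule prob_space_distr) simp
  interpret P: pair_sigma_finite "distr M borel U" "distr M borel Z" ..
  have S [measurable]: "{p::real \<times> real. fst p \<le> snd p} \<in> sets (borel \<Otimes>\<^sub>M borel)"
    unfolding borel_prod by (intro borel_closed closed_Collect_le continuous_intros)
  have "emeasure M {\<omega> \<in> space M. U \<omega> \<le> Z \<omega>}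
      = emeasure (distr M (borel \<Otimes>\<^sub>M borel) (\<lambda>\<omega>. (U \<omega>, Z \<omega>))) {p. fst p \<le> snd p}"
    by (subst emeasure_distr) (auto intro!: arg_cong[where f = "emeasure M"])
  also have "\<dots> = emeasure (distr M borel U \<Otimes>\<^sub>M distr M borel Z) {p. fst p \<le> snd p}"
    using ind by (simp add: indep_var_distribution_eq)
  also have "\<dots> = (\<integral>\<^sup>+z. emeasure (distr M borel U) ((\<lambda>u. (u, z)) -` {p. fst p \<le> snd p}) \<partial>distr M borel Z)"
    by (rule P.emeasure_pair_measure_alt2) (use S in simp)
  also have "\<dots> \<le> (\<integral>\<^sup>+z. ennreal z \<partial>distr M borel Z)"
  proof (rule nn_integral_mono)
    fix z :: real
    have "emeasure (distr M borel U) {..z} = emeasure lborel ({0<..<1} \<inter> {..z})"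
      unfolding unif by (subst emeasure_uniform_measure) (auto simp: divide_ennreal_def)
    \<comment> \<open>Dropping the cap at 1 is the only loss. The \<open>max\<close> covers negative
      \<open>z\<close>, where the mass and \<open>ennreal z\<close> are both 0.\<close>
    also have "\<dots> \<le> emeasure lborel {0<..max 0 z}"
      by (rule emeasure_mono) auto
    also have "\<dots> = ennreal z"
      by (auto simp: max_def ennreal_neg)
    finally show "emeasure (distr M borel U) ((\<lambda>u. (u, z)) -` {p. fst p \<le> snd p}) \<le> ennreal z"
      by (simp add: vimage_def atMost_def)
  qed
  also have "\<dots> = (\<integral>\<^sup>+\<omega>. ennreal (Z \<omega>) \<partial>M)"
    by (subst nn_integral_distr) auto
  finally show ?thesis .
qed

text \<open>The exponential of the sum is a product, and independence factors its integral.
  Nonnegative integrals spare an integrability argument for the product; the integrability in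
  \<open>subgaussian\<close> converts each factor back to an expectation.\<close>

lemma (in prob_space) subgaussian_sum_mgf_le:
  fixes X :: "'i \<Rightarrow> 'a \<Rightarrow> real"
  assumes I: "finite I" and ind: "indep_vars (\<lambda>_. borel) X I"
    and sub: "\<And>i. i \<in> I \<Longrightarrow> subgaussian M \<sigma> (X i)"
  shows "(\<integral>\<^sup>+\<omega>. ennreal (exp (l * (\<Sum>i\<in>I. X i \<omega> - expectation (X i)))) \<partial>M)
    \<le> ennreal (exp (card I * (l\<^sup>2 * \<sigma>\<^sup>2 / 2)))"
proof -
  have "(\<integral>\<^sup>+\<omega>. ennreal (exp (l * (\<Sum>i\<in>I. X i \<omega> - expectation (X i)))) \<partial>M)
      = (\<integral>\<^sup>+\<omega>. (\<Prod>i\<in>I. ennreal (exp (l * (X i \<omega> - expectation (X i))))) \<partial>M)"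
    using I by (simp add: sum_distrib_left exp_sum prod_ennreal)
  also have "\<dots> = (\<Prod>i\<in>I. \<integral>\<^sup>+\<omega>. ennreal (exp (l * (X i \<omega> - expectation (X i)))) \<partial>M)"
    by (rule indep_vars_nn_integral[OF I indep_vars_compose2[OF ind]]) auto
  also have "\<dots> \<le> (\<Prod>i\<in>I. ennreal (exp (l\<^sup>2 * \<sigma>\<^sup>2 / 2)))"
  proof (rule prod_mono_ennreal)
    fix i assume "i \<in> I"
    then have "integrable M (\<lambda>\<omega>. exp (l * (X i \<omega> - expectation (X i))))"
      and "expectation (\<lambda>\<omega>. exp (l * (X i \<omega> - expectation (X i)))) \<le> exp (l\<^sup>2 * \<sigma>\<^sup>2 / 2)"
      using sub by (auto simp: subgaussian_def)
    then show "(\<integral>\<^sup>+\<omega>. ennreal (exp (l * (X i \<omega> - expectation (X i)))) \<partial>M)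
        \<le> ennreal (exp (l\<^sup>2 * \<sigma>\<^sup>2 / 2))"
      by (subst nn_integral_eq_integral) (auto intro: ennreal_leI)
  qed
  also have "\<dots> = ennreal (exp (card I * (l\<^sup>2 * \<sigma>\<^sup>2 / 2)))"
    by (simp only: prod_constant ennreal_power exp_ge_zero exp_of_nat_mult)
  finally show ?thesis .
qed

text \<open>Multiplying by the positive number
  \<open>sqrt (2 * n * ln (1 / \<alpha>)) / \<sigma>\<close> frees \<open>ln u\<close> of its
  coefficient; exponentiating then gives the right side. Here \<open>s\<close> stands for the
  centered sum.\<close>

lemma chernoff_threshold_iff:
  fixes n :: nat and \<sigma> \<alpha> u s :: real
  assumes "n \<ge> 1" "\<sigma> > 0" "0 < \<alpha>" "\<alpha> < 1" "u > 0"
  defines "l \<equiv> sqrt (2 * ln (1 / \<alpha>) / n) / \<sigma>"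
  shows "\<sigma> * sqrt (2 * ln (1 / \<alpha>) / n) + \<sigma> * (ln u / sqrt (2 * real n * ln (1 / \<alpha>))) \<le> s / n
    \<longleftrightarrow> u \<le> \<alpha>\<^sup>2 * exp (l * s)"
proof -
  define L where "L = ln (1 / \<alpha>)"
  \<comment> \<open>With \<open>r\<close> and \<open>q\<close> the two square roots become
    \<open>r / q\<close> and \<open>r * q\<close>, so only field arithmetic remains.\<close>
  define r where "r = sqrt (2 * L)"
  define q where "q = sqrt (real n)"
  have L: "L > 0" "ln \<alpha> = - L" using assms by (auto simp: L_def ln_div)
  have r: "r > 0" "r * r = 2 * L" using L by (auto simp: r_def)
  have q: "q > 0" "real n = q * q" using assms by (auto simp: q_def)
  have l: "l = r / q / \<sigma>"
    by (simp add: l_def L_def[symmetric] r_def q_def real_sqrt_divide)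
  have c: "sqrt (2 * real n * L) = r * q"
    by (simp add: r_def q_def real_sqrt_mult)
  have "\<sigma> * (r / q) + \<sigma> * (ln u / (r * q)) \<le> s / n
      \<longleftrightarrow> (\<sigma> * (r / q) + \<sigma> * (ln u / (r * q))) * (r * q / \<sigma>) \<le> s / n * (r * q / \<sigma>)"
    using r q assms by (intro mult_le_cancel_right_pos[symmetric]) auto
  also have "(\<sigma> * (r / q) + \<sigma> * (ln u / (r * q))) * (r * q / \<sigma>) = r * r + ln u"
    using r(1) q(1) assms(2) by (simp add: field_simps)
  also have "s / n * (r * q / \<sigma>) = l * s"
    using q(1) assms(2) unfolding l q(2) by (simp add: field_simps)
  \<comment> \<open>Since \<open>r * r = - 2 * ln \<alpha>\<close>, moving it across produces the
    factor \<open>\<alpha>\<^sup>2\<close>.\<close>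
  also have "r * r + ln u \<le> l * s \<longleftrightarrow> ln u \<le> ln (\<alpha>\<^sup>2 * exp (l * s))"
    using assms L r by (simp add: ln_mult ln_realpow) linarith
  also have "\<dots> \<longleftrightarrow> u \<le> \<alpha>\<^sup>2 * exp (l * s)"
    using assms by (intro ln_le_cancel_iff) auto
  finally show ?thesis
    by (simp only: L_def[symmetric] c real_sqrt_divide r_def[symmetric] q_def[symmetric])
qed

theorem theorem3p1:
  fixes M :: "'a measure" and n :: nat and X :: "nat \<Rightarrow> 'a \<Rightarrow> real"
    and U :: "'a \<Rightarrow> real" and \<sigma> :: real
  assumes "prob_space M"
    and "n \<ge> 1"
    and "\<sigma> > 0"
    and "iid M {1..n} X"
    and "\<forall>i\<in>{1..n}. subgaussian M \<sigma> (X i)"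
    and "distr M borel U = uniform_measure lborel {0<..<1}"
    and "indep_rv M borel U (Pi\<^sub>M {1..n} (\<lambda>_. borel)) (\<lambda>\<omega>. \<lambda>i\<in>{1..n}. X i \<omega>)"
  shows "\<forall>\<alpha>\<in>{0<..<1}.
    measure M {\<omega> \<in> space M.
      sample_mean n X \<omega> - (\<integral>\<omega>'. X 1 \<omega>' \<partial>M) \<ge>
        \<sigma> * sqrt (2 * ln (1 / \<alpha>) / real n)
        + \<sigma> * (ln (U \<omega>) / sqrt (2 * real n * ln (1 / \<alpha>)))} \<le> \<alpha>"
proof
  fix \<alpha> :: real assume "\<alpha> \<in> {0<..<1}"
  then have \<alpha>: "0 < \<alpha>" "\<alpha> < 1" by auto
  interpret prob_space M by fact
  have ind: "indep_vars (\<lambda>_. borel) X {1..n}"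
    using assms(4) unfolding iid_def by (rule conjunct1)
  have "1 \<in> {1..n}"
    using assms(2) by simp
  then have same: "distr M borel (X i) = distr M borel (X 1)" if "i \<in> {1..n}" for i
    using assms(4) that unfolding iid_def by blast
  have X [measurable]: "X i \<in> borel_measurable M" if "i \<in> {1..n}" for i
    using ind that by (auto simp: indep_vars_def)
  have U [measurable]: "U \<in> borel_measurable M"
    using assms(7) by (simp add: indep_rv_def)
  define \<mu> where "\<mu> = expectation (X 1)"
  \<comment> \<open>\<open>subgaussian\<close> centers each \<open>X i\<close> at its own mean, the
    theorem at that of \<open>X 1\<close>; equal laws identify them.\<close>
  have mean: "expectation (X i) = \<mu>" if i: "i \<in> {1..n}" for i
  proof -
    have "expectation (X i) = (\<integral>x. x \<partial>distr M borel (X i))"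
      using X[OF i] by (subst integral_distr) auto
    also have "\<dots> = (\<integral>x. x \<partial>distr M borel (X 1))"
      by (simp add: same[OF i])
    also have "\<dots> = \<mu>"
      using X[of 1] assms(2) by (subst integral_distr) (auto simp: \<mu>_def)
    finally show ?thesis .
  qed
  \<comment> \<open>This \<open>l\<close> minimizes the Chernoff exponent
    \<open>n * (l\<^sup>2 * \<sigma>\<^sup>2 / 2 - l * t)\<close> at the deterministic threshold
    \<open>t = \<sigma> * sqrt (2 * ln (1 / \<alpha>) / n)\<close>.\<close>
  define l where "l = sqrt (2 * ln (1 / \<alpha>) / n) / \<sigma>"
  define Z where "Z = (\<lambda>\<omega>. \<alpha>\<^sup>2 * exp (l * (\<Sum>i\<in>{1..n}. X i \<omega> - \<mu>)))"
  let ?E = "{\<omega> \<in> space M. sample_mean n X \<omega> - (\<integral>\<omega>'. X 1 \<omega>' \<partial>M) \<ge>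
        \<sigma> * sqrt (2 * ln (1 / \<alpha>) / real n)
        + \<sigma> * (ln (U \<omega>) / sqrt (2 * real n * ln (1 / \<alpha>)))}"
  \<comment> \<open>\<open>Z\<close> is a function of the whole sample vector, so independence of
    \<open>U\<close> from the joint vector is what applies.\<close>
  have Zind: "indep_var borel U borel Z"
  proof -
    have "indep_var borel U borel
        (\<lambda>\<omega>. (\<lambda>x. \<alpha>\<^sup>2 * exp (l * (\<Sum>i\<in>{1..n}. x i - \<mu>))) (\<lambda>i\<in>{1..n}. X i \<omega>))"
      by (rule indep_rv_compose[OF assms(7)]) measurable
    then show ?thesis by (simp add: Z_def)
  qed
  have [measurable]: "Z \<in> borel_measurable M"
    using indep_var_rv2[OF Zind] .
  have "AE u in distr M borel U. 0 < u"
    unfolding assms(6) by (rule AE_uniform_measureI) auto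
  then have pos: "AE \<omega> in M. 0 < U \<omega>"
    by (simp add: AE_distr_iff)
  have iff: "sample_mean n X \<omega> - (\<integral>\<omega>'. X 1 \<omega>' \<partial>M) \<ge>
        \<sigma> * sqrt (2 * ln (1 / \<alpha>) / real n)
        + \<sigma> * (ln (U \<omega>) / sqrt (2 * real n * ln (1 / \<alpha>))) \<longleftrightarrow> U \<omega> \<le> Z \<omega>"
    if "0 < U \<omega>" for \<omega>
  proof -
    have "sample_mean n X \<omega> - (\<integral>\<omega>'. X 1 \<omega>' \<partial>M) = (\<Sum>i\<in>{1..n}. X i \<omega> - \<mu>) / n"
      using assms(2) by (simp add: sample_mean_def \<mu>_def sum_subtractf diff_divide_distrib)
    then show ?thesis
      using chernoff_threshold_iff[OF assms(2,3) \<alpha> that] by (simp add: Z_def l_def)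
  qed
  \<comment> \<open>The logarithm can be inverted only where \<open>U\<close> is positive, so the
    inclusion of events holds almost everywhere.\<close>
  have "emeasure M ?E \<le> emeasure M {\<omega> \<in> space M. U \<omega> \<le> Z \<omega>}"
  proof (rule emeasure_mono_AE)
    show "AE \<omega> in M. \<omega> \<in> ?E \<longrightarrow> \<omega> \<in> {\<omega> \<in> space M. U \<omega> \<le> Z \<omega>}"
      using pos by eventually_elim (use iff in blast)
  qed measurable
  also have "\<dots> \<le> (\<integral>\<^sup>+\<omega>. ennreal (Z \<omega>) \<partial>M)"
    by (rule randomized_Markov[OF Zind assms(6)])
  also have "\<dots> = ennreal (\<alpha>\<^sup>2) * (\<integral>\<^sup>+\<omega>. ennreal (exp (l * (\<Sum>i\<in>{1..n}. X i \<omega> - expectation (X i)))) \<partial>M)"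
  proof -
    have "(\<Sum>i\<in>{1..n}. X i \<omega> - expectation (X i)) = (\<Sum>i\<in>{1..n}. X i \<omega> - \<mu>)" for \<omega>
      by (rule sum.cong) (simp_all only: mean)
    then show ?thesis
      using X by (subst nn_integral_cmult[symmetric]) (simp_all add: Z_def ennreal_mult)
  qed
  also have "\<dots> \<le> ennreal (\<alpha>\<^sup>2) * ennreal (exp (card {1..n} * (l\<^sup>2 * \<sigma>\<^sup>2 / 2)))"
    using assms(5) by (intro mult_left_mono subgaussian_sum_mgf_le[OF _ ind]) auto
  \<comment> \<open>The moment bound is thus \<open>1 / \<alpha>\<close>, which cancels one of the
    two factors \<open>\<alpha>\<close>.\<close>
  also have "card {1..n} * (l\<^sup>2 * \<sigma>\<^sup>2 / 2) = ln (1 / \<alpha>)"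
    using assms(2,3) \<alpha> by (simp add: l_def power_divide)
  also have "ennreal (\<alpha>\<^sup>2) * ennreal (exp (ln (1 / \<alpha>))) = ennreal \<alpha>"
    using \<alpha> by (simp add: ennreal_mult[symmetric] power2_eq_square)
  finally show "measure M ?E \<le> \<alpha>"
    using \<alpha> by (simp add: emeasure_eq_measure)
qed

end
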